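(* Let $\phi : X\to Y$ be a continuous map of topological spaces which is filterhaft, let $Y$ be a $T_0$-space, and let $\psi : Y\to\mathrm{Filt}\,X$ be the map sending $y$ to the filter generated by $\{\phi^{-1}(V) : V\subseteq Y \text{ open}, y\in V\}$. Then $\psi$ is a topological embedding. If moreover $\phi$ is a dense embedding, then $\psi$ is a dense embedding of $Y$ into $\mathrm{Filt}^\circ X$ and $\psi\circ\phi = i$, where $i : X\to\mathrm{Filt}^\circ X$ is the canonical map; in this case $\psi$ is uniquely determined by these properties. Thus every filtrum extension $(\phi,Y)$ of $X$ corresponds (via a homeomorphism compatible with $\phi$ and $i$) to a unique subspace $Y'$ with $i(X)\subseteq Y'\subseteq\mathrm{Filt}^\circ X$, together with the canonical map $i$; and, for $X$ a $T_0$-space, $i: X\to\mathrm{Filt}^\circ X$ is the universal filtrum extension of $X$, i.e. it is a filtrum extension and for every filtrum extension $(\phi,Y)$ there is a unique embedding $\psi:Y\to\mathrm{Filt}^\circ X$ with $\psi\circ\phi=i$.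
   Context: For a topological space $X$, a topological filter on $X$ is a set $F$ of open subsets of $X$ with $X\in F$, closed under finite intersections, and containing with each $U\in F$ every open set $U'\supseteq U$. $F$ is consistent if $\emptyset\notin F$. $\mathrm{Filt}\,X$ is the set of all topological filters on $X$ with the topology having as basis the sets $D(U)=\{F: U\in F\}$, $U\subseteq X$ open; $\mathrm{Filt}^\circ X$ is the subspace of consistent filters. The canonical map $i$ sends $x$ to its neighborhood filter $U(x)=\{U\text{ open}: x\in U\}$. The filter generated by a set of open sets is the smallest topological filter containing it. A continuous map $\phi : X\to Y$ is called filterhaft if for every $y\in Y$ and every open $W\ni y$ there is an open $V$ with $y\in V\subseteq W$ such that for every open $V'\subseteq Y$: $\phi^{-1}(V')\subseteq\phi^{-1}(V)$ implies $V'\subseteq W$. $(\phi,Y)$ is called a filtrum extension of $X$ if $Y$ is a $T_0$-space and $\phi$ is a dense (i.e. with dense image) filterhaft embedding. An embedding is a homeomorphism onto its image. *)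

theory Defs
  imports "HOL-Analysis.Analysis"
begin

text \<open>Spaces are terms of type \<^typ>\<open>'a topology\<close>, so a preimage under a map out of \<open>X\<close> is
  taken relative to \<open>topspace X\<close>, and maps matter only on the topspace of their domain.\<close>

abbreviation preimage_in :: "'a topology \<Rightarrow> ('a \<Rightarrow> 'b) \<Rightarrow> 'b set \<Rightarrow> 'a set" where
  "preimage_in X f V \<equiv> {x \<in> topspace X. f x \<in> V}"

definition topological_filter :: "'a topology \<Rightarrow> 'a set set \<Rightarrow> bool" where
  "topological_filter X F \<longleftrightarrow>
     (\<forall>U\<in>F. openin X U) \<and>
     topspace X \<in> F \<and>
     (\<forall>U\<in>F. \<forall>V\<in>F. U \<inter> V \<in> F) \<and>
     (\<forall>U\<in>F. \<forall>U'. openin X U' \<and> U \<subseteq> U' \<longrightarrow> U' \<in> F)"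

definition consistent :: "'a set set \<Rightarrow> bool" where
  "consistent F \<longleftrightarrow> {} \<notin> F"

definition filt_basic :: "'a topology \<Rightarrow> 'a set \<Rightarrow> 'a set set set" where
  "filt_basic X U = {F. topological_filter X F \<and> U \<in> F}"

definition Filt :: "'a topology \<Rightarrow> 'a set set topology" where
  "Filt X = topology (arbitrary union_of (\<lambda>B. \<exists>U. openin X U \<and> B = filt_basic X U))"

text \<open>The sets \<^term>\<open>filt_basic X U\<close> are closed under binary intersection, so the above
  does define a topology with them as a basis.\<close>

lemma filt_basic_Int:
  assumes "openin X U" "openin X V"
  shows "filt_basic X U \<inter> filt_basic X V = filt_basic X (U \<inter> V)"
proof (intro set_eqI iffI)
  fix F assume F: "F \<in> filt_basic X U \<inter> filt_basic X V"
  then have *: "topological_filter X F" "U \<in> F" "V \<in> F"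
    by (simp_all add: filt_basic_def)
  from *(1) have "\<forall>U\<in>F. \<forall>V\<in>F. U \<inter> V \<in> F"
    unfolding topological_filter_def by (elim conjE)
  from this[rule_format, OF *(2,3)] show "F \<in> filt_basic X (U \<inter> V)"
    using *(1) by (simp add: filt_basic_def)
next
  fix F assume "F \<in> filt_basic X (U \<inter> V)"
  then have *: "topological_filter X F" "U \<inter> V \<in> F"
    by (simp_all add: filt_basic_def)
  from *(1) have "\<forall>U\<in>F. \<forall>U'. openin X U' \<and> U \<subseteq> U' \<longrightarrow> U' \<in> F"
    unfolding topological_filter_def by (elim conjE)
  from bspec[OF this *(2)] have "openin X W \<and> U \<inter> V \<subseteq> W \<longrightarrow> W \<in> F" for W
    by (rule spec)
  from this[rule_format, of U] this[rule_format, of V]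
  show "F \<in> filt_basic X U \<inter> filt_basic X V"
    using *(1) assms by (simp add: filt_basic_def)
qed

lemma openin_Filt:
  "openin (Filt X) = arbitrary union_of (\<lambda>B. \<exists>U. openin X U \<and> B = filt_basic X U)"
proof -
  have "istopology (arbitrary union_of (\<lambda>B. \<exists>U. openin X U \<and> B = filt_basic X U))"
  proof (rule istopology_base)
    fix S T
    assume "\<exists>U. openin X U \<and> S = filt_basic X U" "\<exists>U. openin X U \<and> T = filt_basic X U"
    then obtain U V where "openin X U" "S = filt_basic X U" "openin X V" "T = filt_basic X V"
      by (elim exE conjE)
    then have "openin X (U \<inter> V) \<and> S \<inter> T = filt_basic X (U \<inter> V)"
      by (simp add: filt_basic_Int openin_Int)
    then show "\<exists>W. openin X W \<and> S \<inter> T = filt_basic X W" ..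
  qed
  then show ?thesis
    by (simp add: Filt_def topology_inverse')
qed

lemma topspace_Filt: "topspace (Filt X) = Collect (topological_filter X)"
proof
  show "topspace (Filt X) \<subseteq> Collect (topological_filter X)"
  proof
    fix F assume F: "F \<in> topspace (Filt X)"
    have "(arbitrary union_of (\<lambda>B. \<exists>U. openin X U \<and> B = filt_basic X U)) (topspace (Filt X))"
      using openin_topspace[of "Filt X"] by (simp only: openin_Filt)
    from this[unfolded arbitrary_union_of_alt, rule_format, OF F]
    obtain U where "F \<in> filt_basic X U"
      by (elim exE conjE) simp
    then show "F \<in> Collect (topological_filter X)"
      by (simp add: filt_basic_def)
  qed
  have "openin (Filt X) (filt_basic X (topspace X))"
    unfolding openin_Filt by (intro arbitrary_union_of_inc exI[of _ "topspace X"]) simp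
  then have "filt_basic X (topspace X) \<subseteq> topspace (Filt X)"
    by (rule openin_subset)
  moreover have "F \<in> filt_basic X (topspace X)" if "topological_filter X F" for F
  proof -
    from that have "topspace X \<in> F"
      unfolding topological_filter_def by (elim conjE)
    with that show ?thesis
      by (simp add: filt_basic_def)
  qed
  ultimately show "Collect (topological_filter X) \<subseteq> topspace (Filt X)"
    by (simp add: subset_iff)
qed

definition consistent_Filt :: "'a topology \<Rightarrow> 'a set set topology" where
  "consistent_Filt X = subtopology (Filt X) (Collect consistent)"

definition nhd_filter :: "'a topology \<Rightarrow> 'a \<Rightarrow> 'a set set" where
  "nhd_filter X x = {U. openin X U \<and> x \<in> U}"

definition generated_filter :: "'a topology \<Rightarrow> 'a set set \<Rightarrow> 'a set set" where
  "generated_filter X S = topological_filter X hull S"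

definition filterhaft :: "'a topology \<Rightarrow> 'b topology \<Rightarrow> ('a \<Rightarrow> 'b) \<Rightarrow> bool" where
  "filterhaft X Y \<phi> \<longleftrightarrow>
     continuous_map X Y \<phi> \<and>
     (\<forall>y\<in>topspace Y. \<forall>W. openin Y W \<and> y \<in> W \<longrightarrow>
        (\<exists>V. openin Y V \<and> y \<in> V \<and> V \<subseteq> W \<and>
           (\<forall>V'. openin Y V' \<and> preimage_in X \<phi> V' \<subseteq> preimage_in X \<phi> V \<longrightarrow> V' \<subseteq> W)))"

definition dense_embedding :: "'a topology \<Rightarrow> 'b topology \<Rightarrow> ('a \<Rightarrow> 'b) \<Rightarrow> bool" where
  "dense_embedding X Y f \<longleftrightarrow>
     embedding_map X Y f \<and> Y closure_of (f ` topspace X) = topspace Y"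

definition filtrum_extension :: "'a topology \<Rightarrow> 'b topology \<Rightarrow> ('a \<Rightarrow> 'b) \<Rightarrow> bool" where
  "filtrum_extension X Y \<phi> \<longleftrightarrow> t0_space Y \<and> filterhaft X Y \<phi> \<and> dense_embedding X Y \<phi>"

definition filter_map ::
    "'a topology \<Rightarrow> 'b topology \<Rightarrow> ('a \<Rightarrow> 'b) \<Rightarrow> 'b \<Rightarrow> 'a set set" where
  "filter_map X Y \<phi> y = generated_filter X {preimage_in X \<phi> V |V. openin Y V \<and> y \<in> V}"

end

theory Submission
  imports Defs
begin

text \<open>Write \<open>D(U)\<close> for the basic open set of filters containing \<open>U\<close>, and \<open>\<psi>\<close> for
  \<^term>\<open>filter_map X Y \<phi>\<close>. A map \<open>f\<close> into \<^term>\<open>Filt X\<close> amounts to a relation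
  \<open>U \<in> f y\<close>, and for a \<open>T\<^sub>0\<close>-space as domain it is an embedding iff its values are filters, all the sets
  \<open>{y. U \<in> f y}\<close> are open, and they form a basis of the domain
  (\<open>embedding_map_Filt_iff\<close>). Everything else is read off from this criterion.

  For \<open>\<psi>\<close> the set \<open>{y. U \<in> \<psi> y}\<close> is the largest open set \<open>V\<close> with \<open>\<phi>\<close>-preimage contained in \<open>U\<close>,
  so it is open; and filterhaftness says precisely that, for \<open>y \<in> W\<close>, some \<open>U\<close> in \<open>\<psi> y\<close> makes
  this largest \<open>V\<close> lie inside \<open>W\<close>. Hence \<open>\<psi>\<close> is an embedding
  (\<open>embedding_map_filter_map\<close>). Density of \<open>\<phi>\<close> makes the filters consistent, and since \<open>\<phi>\<close> is
  an embedding the preimages of the neighbourhoods of \<open>\<phi> x\<close> are all the neighbourhoods of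
  \<open>x\<close>, that is \<open>\<psi> \<circ> \<phi> = i\<close>. Since \<open>i\<close> already has dense image among the consistent filters, so does \<open>\<psi>\<close>.

  An embedding of \<open>Y\<close> that extends \<open>i\<close> along \<open>\<phi>\<close> has no freedom: the sets \<open>{y. U \<in> \<psi> y}\<close> form
  a basis of \<open>Y\<close> and have preimage \<open>U\<close> in \<open>X\<close>, which forces \<open>U \<in> \<psi> y\<close> to mean that
  some open \<open>V\<close> containing \<open>y\<close> has preimage inside \<open>U\<close>
  (\<open>embedding_over_nhd_filter_eq_filter_map\<close>). The unique subspace \<open>Y'\<close> is therefore the image of \<open>\<psi>\<close>.
  Finally the consistent filters form a filtrum extension themselves: the preimage of \<open>D(U)\<close>
  under \<open>i\<close> is \<open>U\<close>, so an open set whose preimage is contained in \<open>U\<close> is a union of sets \<open>D(U')\<close>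
  with \<open>U' \<subseteq> U\<close>, all of them inside \<open>D(U)\<close>.\<close>

section \<open>Continuity of embeddings\<close>

lemma embedding_imp_continuous_map: "embedding_map X Y f \<Longrightarrow> continuous_map X Y f"
  unfolding embedding_map_def
  using continuous_map_in_subtopology homeomorphic_imp_continuous_map by blast

section \<open>Filters of open sets\<close>

lemma topological_filter_nhd_filter:
  "x \<in> topspace X \<Longrightarrow> topological_filter X (nhd_filter X x)"
  unfolding topological_filter_def nhd_filter_def by auto

lemma topological_filter_openin: "topological_filter X F \<Longrightarrow> U \<in> F \<Longrightarrow> openin X U"
  unfolding topological_filter_def by auto

lemma topological_filter_upward:
  "topological_filter X F \<Longrightarrow> U \<in> F \<Longrightarrow> openin X U' \<Longrightarrow> U \<subseteq> U' \<Longrightarrow> U' \<in> F"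
  unfolding topological_filter_def by meson

lemma consistent_nhd_filter: "consistent (nhd_filter X x)"
  unfolding consistent_def nhd_filter_def by auto

text \<open>Preimages of open neighbourhoods of a point are closed under finite intersections, so
  passing to open supersets is all that is needed to generate the filter.\<close>

lemma
  assumes cont: "continuous_map X Y \<phi>" and y: "y \<in> topspace Y"
  shows mem_filter_map: "U \<in> filter_map X Y \<phi> y \<longleftrightarrow>
      openin X U \<and> (\<exists>V. openin Y V \<and> y \<in> V \<and> preimage_in X \<phi> V \<subseteq> U)"
    and topological_filter_filter_map: "topological_filter X (filter_map X Y \<phi> y)"
proof -
  let ?S = "{preimage_in X \<phi> V |V. openin Y V \<and> y \<in> V}"
  let ?G = "{U. openin X U \<and> (\<exists>V. openin Y V \<and> y \<in> V \<and> preimage_in X \<phi> V \<subseteq> U)}"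
  have S: "?S \<subseteq> ?G"
    using cont by (auto simp: continuous_map_def)
  have G: "topological_filter X ?G"
    unfolding topological_filter_def
  proof (intro conjI ballI allI impI)
    show "topspace X \<in> ?G" using y by auto
  next
    fix U U' assume "U \<in> ?G" "U' \<in> ?G"
    then obtain V V' where V: "openin X U" "openin Y V" "y \<in> V" "preimage_in X \<phi> V \<subseteq> U"
      "openin X U'" "openin Y V'" "y \<in> V'" "preimage_in X \<phi> V' \<subseteq> U'" by auto
    have "preimage_in X \<phi> (V \<inter> V') \<subseteq> U \<inter> U'" using V by auto
    moreover have "openin Y (V \<inter> V')" "openin X (U \<inter> U')" using V by auto
    ultimately show "U \<inter> U' \<in> ?G" using V by blast
  next
    fix U U' assume "U \<in> ?G" "openin X U' \<and> U \<subseteq> U'"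
    then show "U' \<in> ?G" by blast
  qed blast
  have eq: "filter_map X Y \<phi> y = ?G"
    unfolding filter_map_def generated_filter_def
  proof (rule hull_unique)
    show "?S \<subseteq> ?G" by (rule S)
    show "topological_filter X ?G" by (rule G)
    fix F assume F: "?S \<subseteq> F" "topological_filter X F"
    show "?G \<subseteq> F"
    proof
      fix U assume "U \<in> ?G"
      then obtain V where V: "openin X U" "openin Y V" "y \<in> V" "preimage_in X \<phi> V \<subseteq> U"
        by auto
      then have "preimage_in X \<phi> V \<in> F" using F(1) by blast
      then show "U \<in> F" using V F(2) topological_filter_upward by blast
    qed
  qed
  then show "U \<in> filter_map X Y \<phi> y \<longleftrightarrow>
      openin X U \<and> (\<exists>V. openin Y V \<and> y \<in> V \<and> preimage_in X \<phi> V \<subseteq> U)" by blast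
  from G show "topological_filter X (filter_map X Y \<phi> y)" by (simp only: eq)
qed

section \<open>The spaces of filters\<close>

lemma openin_Filt_iff:
  "openin (Filt X) T \<longleftrightarrow>
    T \<subseteq> Collect (topological_filter X) \<and> (\<forall>F\<in>T. \<exists>U\<in>F. filt_basic X U \<subseteq> T)"
proof
  assume T: "openin (Filt X) T"
  then have 1: "T \<subseteq> Collect (topological_filter X)"
    using openin_subset topspace_Filt by metis
  from T show "T \<subseteq> Collect (topological_filter X) \<and> (\<forall>F\<in>T. \<exists>U\<in>F. filt_basic X U \<subseteq> T)"
    using 1 unfolding openin_Filt arbitrary_union_of_alt
    by (fastforce simp: filt_basic_def)
next
  assume T: "T \<subseteq> Collect (topological_filter X) \<and> (\<forall>F\<in>T. \<exists>U\<in>F. filt_basic X U \<subseteq> T)"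
  show "openin (Filt X) T"
    unfolding openin_Filt arbitrary_union_of_alt
  proof
    fix F assume F: "F \<in> T"
    with T obtain U where U: "U \<in> F" "filt_basic X U \<subseteq> T" by blast
    have "topological_filter X F" using F T by auto
    with U have "openin X U" "F \<in> filt_basic X U"
      by (auto simp: filt_basic_def topological_filter_openin)
    with U show "\<exists>B. (\<exists>U. openin X U \<and> B = filt_basic X U) \<and> F \<in> B \<and> B \<subseteq> T" by blast
  qed
qed

lemma openin_Filt_basic:
  assumes "openin (Filt X) T" "F \<in> T"
  obtains U where "U \<in> F" "openin X U" "filt_basic X U \<subseteq> T"
proof -
  have "topological_filter X F" "\<exists>U\<in>F. filt_basic X U \<subseteq> T"
    using assms by (auto simp: openin_Filt_iff)
  then show thesis
    using that topological_filter_openin by blast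
qed

lemma openin_filt_basic: "openin (Filt X) (filt_basic X U)"
  unfolding openin_Filt_iff by (auto simp: filt_basic_def)

lemma topspace_consistent_Filt:
  "topspace (consistent_Filt X) = {F. topological_filter X F \<and> consistent F}"
  by (auto simp: consistent_Filt_def topspace_Filt)

lemma openin_consistent_Filt_basic:
  assumes "openin (consistent_Filt X) T" "F \<in> T"
  obtains U where "U \<in> F" "openin X U" "filt_basic X U \<inter> Collect consistent \<subseteq> T"
proof -
  obtain T' where T': "openin (Filt X) T'" "T = T' \<inter> Collect consistent"
    using assms(1) by (auto simp: consistent_Filt_def openin_subtopology)
  have "F \<in> T'" using T'(2) assms(2) by blast
  then obtain U where "U \<in> F" "openin X U" "filt_basic X U \<subseteq> T'"
    by (rule openin_Filt_basic[OF T'(1)])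
  then show thesis
    using that T'(2) by blast
qed

text \<open>The sets \<^term>\<open>{y \<in> topspace Y. U \<in> f y}\<close> are the preimages of the basic open sets, so
  their openness is continuity and their being a basis is openness of the map onto its image.
  Injectivity then comes for free from \<open>T\<^sub>0\<close>, since the filter at a point determines which open
  sets contain the point.\<close>

lemma embedding_map_Filt_iff:
  assumes t0: "t0_space Y"
  shows "embedding_map Y (Filt X) f \<longleftrightarrow>
    (\<forall>y\<in>topspace Y. topological_filter X (f y)) \<and>
    (\<forall>U. openin X U \<longrightarrow> openin Y {y \<in> topspace Y. U \<in> f y}) \<and>
    (\<forall>W y. openin Y W \<and> y \<in> W \<longrightarrow> (\<exists>U\<in>f y. {y' \<in> topspace Y. U \<in> f y'} \<subseteq> W))"
    (is "_ \<longleftrightarrow> ?filter \<and> ?cont \<and> ?basis")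
proof
  assume emb: "embedding_map Y (Filt X) f"
  then have hom: "homeomorphic_map Y (subtopology (Filt X) (f ` topspace Y)) f"
    by (simp add: embedding_map_def)
  have cont: "continuous_map Y (Filt X) f" using emb by (rule embedding_imp_continuous_map)
  then have filter: ?filter
    by (auto simp: continuous_map_def topspace_Filt)
  have "openin Y {y \<in> topspace Y. U \<in> f y}" for U
  proof -
    have "{y \<in> topspace Y. U \<in> f y} = {y \<in> topspace Y. f y \<in> filt_basic X U}"
      using filter by (auto simp: filt_basic_def)
    then show ?thesis using openin_continuous_map_preimage[OF cont openin_filt_basic] by simp
  qed
  moreover have "\<exists>U\<in>f y. {y' \<in> topspace Y. U \<in> f y'} \<subseteq> W" if W: "openin Y W" "y \<in> W" for W y
  proof -
    have "openin (subtopology (Filt X) (f ` topspace Y)) (f ` W)"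
      using homeomorphic_imp_open_map[OF hom] W by (simp add: open_map_def)
    then obtain T where T: "openin (Filt X) T" "f ` W = T \<inter> f ` topspace Y"
      by (auto simp: openin_subtopology)
    have "f y \<in> T" using W(2) T(2) by blast
    then obtain U where U: "U \<in> f y" "openin X U" "filt_basic X U \<subseteq> T"
      by (rule openin_Filt_basic[OF T(1)])
    have "y' \<in> W" if y': "y' \<in> topspace Y" "U \<in> f y'" for y'
    proof -
      have "f y' \<in> f ` W" using T U y' filter by (auto simp: filt_basic_def)
      moreover have "inj_on f (topspace Y)"
        using hom homeomorphic_imp_injective_map by blast
      ultimately show "y' \<in> W" using y' openin_subset[OF W(1)] by (auto dest: inj_onD)
    qed
    with U show ?thesis by blast
  qed
  ultimately show "?filter \<and> ?cont \<and> ?basis" using filter by blast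
next
  assume *: "?filter \<and> ?cont \<and> ?basis"
  then have filter: ?filter and cont: ?cont and basis: ?basis by blast+
  have "continuous_map Y (Filt X) f"
    unfolding continuous_map_def
  proof (intro conjI allI impI)
    show "f \<in> topspace Y \<rightarrow> topspace (Filt X)" using filter by (auto simp: topspace_Filt)
  next
    fix T assume T: "openin (Filt X) T"
    show "openin Y {y \<in> topspace Y. f y \<in> T}"
    proof (subst openin_subopen, intro ballI)
      fix y assume y: "y \<in> {y \<in> topspace Y. f y \<in> T}"
      then have "f y \<in> T" by blast
      then obtain U where U: "U \<in> f y" "openin X U" "filt_basic X U \<subseteq> T"
        by (rule openin_Filt_basic[OF T])
      have "openin Y {y \<in> topspace Y. U \<in> f y}"
        using cont U(2) by blast
      moreover have "{y \<in> topspace Y. U \<in> f y} \<subseteq> {y \<in> topspace Y. f y \<in> T}"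
        using U filter by (auto simp: filt_basic_def)
      ultimately show "\<exists>S. openin Y S \<and> y \<in> S \<and> S \<subseteq> {y \<in> topspace Y. f y \<in> T}"
        using y U by blast
    qed
  qed
  then have "continuous_map Y (subtopology (Filt X) (f ` topspace Y)) f"
    by (simp add: continuous_map_in_subtopology)
  moreover have "open_map Y (subtopology (Filt X) (f ` topspace Y)) f"
    unfolding open_map_def
  proof (intro allI impI)
    fix W assume W: "openin Y W"
    \<comment> \<open>the largest open set of filters with preimage inside \<open>W\<close>\<close>
    let ?T = "\<Union>{filt_basic X U |U. {y \<in> topspace Y. U \<in> f y} \<subseteq> W}"
    have "openin (Filt X) ?T" using openin_filt_basic by blast
    moreover have "f ` W = ?T \<inter> f ` topspace Y"
    proof (intro equalityI subsetI)
      fix F assume "F \<in> f ` W"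
      then obtain y where y: "y \<in> W" "F = f y" by blast
      then have yY: "y \<in> topspace Y" using W openin_subset by blast
      obtain U where "U \<in> f y" "{y' \<in> topspace Y. U \<in> f y'} \<subseteq> W"
        using basis W y by blast
      moreover have "topological_filter X (f y)" using filter yY by blast
      ultimately have "f y \<in> ?T" by (auto simp: filt_basic_def)
      then show "F \<in> ?T \<inter> f ` topspace Y" using y yY by blast
    qed (auto simp: filt_basic_def)
    ultimately show "openin (subtopology (Filt X) (f ` topspace Y)) (f ` W)"
      by (auto simp: openin_subtopology)
  qed
  moreover have "inj_on f (topspace Y)"
  proof (rule inj_onI, rule ccontr)
    fix y z assume yz: "y \<in> topspace Y" "z \<in> topspace Y" "f y = f z" "y \<noteq> z"
    then obtain W where "openin Y W" "(y \<in> W) \<noteq> (z \<in> W)"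
      using t0 unfolding t0_space_def by blast
    moreover have "a \<in> W" if "openin Y W" "b \<in> W" "f a = f b" "a \<in> topspace Y" for a b W
      using basis that by (metis (no_types, lifting) mem_Collect_eq subsetD)
    ultimately show False using yz by metis
  qed
  moreover have "f ` topspace Y \<subseteq> topspace (Filt X)"
    using filter by (auto simp: topspace_Filt)
  ultimately show "embedding_map Y (Filt X) f"
    unfolding embedding_map_def
    by (intro bijective_open_imp_homeomorphic_map) auto
qed

lemma embedding_map_consistent_Filt_iff:
  "embedding_map Y (consistent_Filt X) f \<longleftrightarrow>
    embedding_map Y (Filt X) f \<and> (\<forall>y\<in>topspace Y. consistent (f y))"
  unfolding consistent_Filt_def embedding_map_in_subtopology by auto

text \<open>A nonempty basic open set of consistent filters is given by a nonempty open set, and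
  the neighbourhood filters of the points of the latter lie in the former.\<close>

lemma dense_in_consistent_Filt:
  assumes "nhd_filter X ` topspace X \<subseteq> S"
  shows "consistent_Filt X closure_of S = topspace (consistent_Filt X)"
proof -
  have "\<exists>x\<in>topspace X. nhd_filter X x \<in> T"
    if T: "openin (consistent_Filt X) T" "F \<in> T" for T F
  proof -
    obtain U where U: "U \<in> F" "openin X U" "filt_basic X U \<inter> Collect consistent \<subseteq> T"
      using openin_consistent_Filt_basic[OF T] .
    have "consistent F"
      using T openin_subset[OF T(1)] by (auto simp: topspace_consistent_Filt)
    then have "U \<noteq> {}"
      using U(1) unfolding consistent_def by blast
    then obtain x where "x \<in> U" by blast
    then have x: "x \<in> topspace X" "U \<in> nhd_filter X x"
      using U(2) openin_subset[OF U(2)] by (auto simp: nhd_filter_def)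
    then have "nhd_filter X x \<in> T"
      using U(3) by (auto simp: filt_basic_def topological_filter_nhd_filter consistent_nhd_filter)
    with x show ?thesis by blast
  qed
  then show ?thesis
    using assms unfolding dense_intersects_open by fast
qed

section \<open>Embedding filterhaft spaces\<close>

text \<open>By filterhaftness choose \<open>V\<close> with \<open>y \<in> V\<close> such that every open set with preimage inside that of
  \<open>V\<close> lies in \<open>W\<close>. The union of these open sets is the set of points whose filter contains the
  preimage of \<open>V\<close>.\<close>

lemma embedding_map_filter_map:
  assumes fh: "filterhaft X Y \<phi>" and t0: "t0_space Y"
  shows "embedding_map Y (Filt X) (filter_map X Y \<phi>)"
proof -
  have cont: "continuous_map X Y \<phi>" using fh by (simp add: filterhaft_def)
  note mem = mem_filter_map[OF cont]
  have "openin Y {y \<in> topspace Y. U \<in> filter_map X Y \<phi> y}" if "openin X U" for U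
  proof -
    have "{y \<in> topspace Y. U \<in> filter_map X Y \<phi> y}
        = \<Union>{V. openin Y V \<and> preimage_in X \<phi> V \<subseteq> U}"
      using that openin_subset[of Y] by (auto simp: mem subset_iff)
    then show ?thesis by auto
  qed
  moreover have "\<exists>U\<in>filter_map X Y \<phi> y. {y' \<in> topspace Y. U \<in> filter_map X Y \<phi> y'} \<subseteq> W"
    if W: "openin Y W" "y \<in> W" for W y
  proof -
    have y: "y \<in> topspace Y" using W openin_subset by blast
    then obtain V where V: "openin Y V" "y \<in> V"
      and min: "\<And>V'. openin Y V' \<Longrightarrow> preimage_in X \<phi> V' \<subseteq> preimage_in X \<phi> V \<Longrightarrow> V' \<subseteq> W"
      using fh W unfolding filterhaft_def by meson
    have "preimage_in X \<phi> V \<in> filter_map X Y \<phi> y"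
      using V y cont by (auto simp: mem continuous_map_def)
    moreover have "{y' \<in> topspace Y. preimage_in X \<phi> V \<in> filter_map X Y \<phi> y'} \<subseteq> W"
    proof
      fix y' assume "y' \<in> {y' \<in> topspace Y. preimage_in X \<phi> V \<in> filter_map X Y \<phi> y'}"
      then obtain V' where "openin Y V'" "y' \<in> V'" "preimage_in X \<phi> V' \<subseteq> preimage_in X \<phi> V"
        using mem by blast
      with min show "y' \<in> W" by blast
    qed
    ultimately show ?thesis by blast
  qed
  ultimately show ?thesis
    using topological_filter_filter_map[OF cont]
    unfolding embedding_map_Filt_iff[OF t0] by blast
qed

lemma consistent_filter_map:
  assumes "continuous_map X Y \<phi>" "Y closure_of (\<phi> ` topspace X) = topspace Y" "y \<in> topspace Y"
  shows "consistent (filter_map X Y \<phi> y)"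
proof -
  have "preimage_in X \<phi> V \<noteq> {}" if "openin Y V" "y \<in> V" for V
    using assms(2) that unfolding dense_intersects_open by blast
  then show ?thesis
    unfolding consistent_def mem_filter_map[OF assms(1,3)] by auto
qed

text \<open>The topology of \<open>X\<close> is induced along an embedding, so every open neighbourhood of \<open>x\<close> is
  itself the preimage of an open set of \<open>Y\<close>.\<close>

lemma filter_map_image_eq_nhd_filter:
  assumes emb: "embedding_map X Y \<phi>" and x: "x \<in> topspace X"
  shows "filter_map X Y \<phi> (\<phi> x) = nhd_filter X x"
proof -
  have hom: "homeomorphic_map X (subtopology Y (\<phi> ` topspace X)) \<phi>"
    using emb by (simp add: embedding_map_def)
  have cont: "continuous_map X Y \<phi>" using emb by (rule embedding_imp_continuous_map)
  then have "\<phi> x \<in> topspace Y" using x by (auto simp: continuous_map_def)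
  note mem = mem_filter_map[OF cont this]
  have "\<exists>V. openin Y V \<and> \<phi> x \<in> V \<and> preimage_in X \<phi> V \<subseteq> U" if U: "openin X U" "x \<in> U" for U
  proof -
    have "openin (subtopology Y (\<phi> ` topspace X)) (\<phi> ` U)"
      using homeomorphic_imp_open_map[OF hom] U by (simp add: open_map_def)
    then obtain V where V: "openin Y V" "\<phi> ` U = V \<inter> \<phi> ` topspace X"
      by (auto simp: openin_subtopology)
    have "inj_on \<phi> (topspace X)" using hom homeomorphic_imp_injective_map by blast
    then have "preimage_in X \<phi> V \<subseteq> U"
      using V openin_subset[OF U(1)] by (fastforce dest: inj_onD)
    with V U show ?thesis by blast
  qed
  then show ?thesis
    using x by (auto simp: set_eq_iff mem nhd_filter_def)
qed

text \<open>If \<open>U \<in> \<psi> y\<close>, then \<^term>\<open>{y \<in> topspace Y. U \<in> \<psi> y}\<close> is an open neighbourhood of \<open>y\<close> with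
  preimage \<open>U\<close>. Conversely, any open \<open>V\<close> containing \<open>y\<close> contains such a neighbourhood for some
  \<open>U' \<in> \<psi> y\<close>, and comparing preimages puts \<open>U'\<close> inside the preimage of \<open>V\<close>.\<close>

lemma embedding_over_nhd_filter_eq_filter_map:
  assumes t0: "t0_space Y" and cont: "continuous_map X Y \<phi>"
    and emb: "embedding_map Y (consistent_Filt X) \<psi>"
    and comp: "\<And>x. x \<in> topspace X \<Longrightarrow> \<psi> (\<phi> x) = nhd_filter X x"
    and y: "y \<in> topspace Y"
  shows "\<psi> y = filter_map X Y \<phi> y"
proof -
  have filter: "topological_filter X (\<psi> y)"
    and open_mem: "\<And>U. openin X U \<Longrightarrow> openin Y {y \<in> topspace Y. U \<in> \<psi> y}"
    and basis: "\<And>V. openin Y V \<Longrightarrow> y \<in> V \<Longrightarrow> \<exists>U\<in>\<psi> y. {y' \<in> topspace Y. U \<in> \<psi> y'} \<subseteq> V"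
    using emb y by (auto simp: embedding_map_consistent_Filt_iff embedding_map_Filt_iff[OF t0])
  have pre: "preimage_in X \<phi> {y \<in> topspace Y. U \<in> \<psi> y} = U" if "openin X U" for U
    using cont that openin_subset[OF that]
    by (auto simp: comp nhd_filter_def continuous_map_def)
  show ?thesis
  proof (intro equalityI subsetI)
    fix U assume U: "U \<in> \<psi> y"
    then have "openin X U" using filter topological_filter_openin by blast
    with U y open_mem pre show "U \<in> filter_map X Y \<phi> y"
      unfolding mem_filter_map[OF cont y] by blast
  next
    fix U assume "U \<in> filter_map X Y \<phi> y"
    then obtain V where V: "openin X U" "openin Y V" "y \<in> V" "preimage_in X \<phi> V \<subseteq> U"
      unfolding mem_filter_map[OF cont y] by blast
    then obtain U' where U': "U' \<in> \<psi> y" "{y' \<in> topspace Y. U' \<in> \<psi> y'} \<subseteq> V"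
      using basis by blast
    then have "U' \<subseteq> preimage_in X \<phi> V"
      using pre[of U'] filter topological_filter_openin by blast
    with V U' filter show "U \<in> \<psi> y" using topological_filter_upward by blast
  qed
qed

corollary filtrum_extension_unique:
  assumes "filtrum_extension X Y \<phi>" "embedding_map Y (consistent_Filt X) \<psi>"
    and "\<forall>x\<in>topspace X. \<psi> (\<phi> x) = nhd_filter X x" "y \<in> topspace Y"
  shows "\<psi> y = filter_map X Y \<phi> y"
  using assms unfolding filtrum_extension_def filterhaft_def
  by (intro embedding_over_nhd_filter_eq_filter_map) auto

lemma dense_embedding_filter_map:
  assumes fe: "filtrum_extension X Y \<phi>"
  shows "dense_embedding Y (consistent_Filt X) (filter_map X Y \<phi>)"
proof -
  have *: "t0_space Y" "filterhaft X Y \<phi>" "embedding_map X Y \<phi>"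
    "Y closure_of (\<phi> ` topspace X) = topspace Y"
    using fe by (auto simp: filtrum_extension_def dense_embedding_def)
  then have cont: "continuous_map X Y \<phi>" by (simp add: filterhaft_def)
  have "nhd_filter X ` topspace X \<subseteq> filter_map X Y \<phi> ` topspace Y"
  proof
    fix F assume "F \<in> nhd_filter X ` topspace X"
    then obtain x where "x \<in> topspace X" "F = filter_map X Y \<phi> (\<phi> x)"
      using filter_map_image_eq_nhd_filter[OF *(3)] by auto
    then show "F \<in> filter_map X Y \<phi> ` topspace Y"
      using cont by (auto simp: continuous_map_def)
  qed
  then show ?thesis
    using * cont unfolding dense_embedding_def
    by (simp add: embedding_map_consistent_Filt_iff embedding_map_filter_map
        consistent_filter_map dense_in_consistent_Filt)
qed

section \<open>The universal filtrum extension\<close>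

lemma t0_space_consistent_Filt: "t0_space (consistent_Filt X)"
proof -
  have "\<exists>T. openin (Filt X) T \<and> (F \<notin> T \<longleftrightarrow> G \<in> T)"
    if FG: "topological_filter X F" "topological_filter X G" "F \<noteq> G" for F G
  proof -
    obtain U where "(U \<in> F) \<noteq> (U \<in> G)" using FG(3) by blast
    then have "F \<notin> filt_basic X U \<longleftrightarrow> G \<in> filt_basic X U"
      using FG by (auto simp: filt_basic_def)
    then show ?thesis using openin_filt_basic by blast
  qed
  then have "t0_space (Filt X)"
    unfolding t0_space_def topspace_Filt by blast
  then show ?thesis unfolding consistent_Filt_def by (rule t0_space_subtopology)
qed

lemma preimage_nhd_filter_filt_basic:
  assumes "openin X U"
  shows "preimage_in X (nhd_filter X) (filt_basic X U) = U"
  using assms openin_subset[OF assms]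
  by (auto simp: filt_basic_def topological_filter_nhd_filter) (auto simp: nhd_filter_def)

text \<open>Filterhaftness holds with \<open>V\<close> any basic open set below \<open>W\<close>, because filters are closed under
  passing to open supersets: an open set of consistent filters whose preimage lies in \<open>U\<close> only
  contains filters having a member below \<open>U\<close>.\<close>

lemma filtrum_extension_consistent_Filt:
  assumes t0: "t0_space X"
  shows "filtrum_extension X (consistent_Filt X) (nhd_filter X)"
proof -
  have mem: "{x \<in> topspace X. U \<in> nhd_filter X x} = U" if "openin X U" for U
    using that openin_subset[OF that] by (auto simp: nhd_filter_def)
  have emb: "embedding_map X (consistent_Filt X) (nhd_filter X)"
    unfolding embedding_map_consistent_Filt_iff embedding_map_Filt_iff[OF t0]
  proof (intro conjI ballI allI impI)
    show "\<exists>U\<in>nhd_filter X x. {x' \<in> topspace X. U \<in> nhd_filter X x'} \<subseteq> W"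
      if "openin X W \<and> x \<in> W" for W x
      using that mem by (intro bexI[of _ W]) (auto simp: nhd_filter_def)
  qed (simp_all add: mem topological_filter_nhd_filter consistent_nhd_filter)
  then have cont: "continuous_map X (consistent_Filt X) (nhd_filter X)"
    by (rule embedding_imp_continuous_map)
  have "\<exists>V. openin (consistent_Filt X) V \<and> F \<in> V \<and> V \<subseteq> W \<and>
      (\<forall>V'. openin (consistent_Filt X) V' \<and>
         preimage_in X (nhd_filter X) V' \<subseteq> preimage_in X (nhd_filter X) V \<longrightarrow> V' \<subseteq> W)"
    if W: "openin (consistent_Filt X) W" "F \<in> W" for F W
  proof -
    have pre: "preimage_in X (nhd_filter X) (filt_basic X U \<inter> Collect consistent) = U"
      if "openin X U" for U
      using preimage_nhd_filter_filt_basic[OF that] consistent_nhd_filter by auto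
    obtain U where U: "U \<in> F" "openin X U" "filt_basic X U \<inter> Collect consistent \<subseteq> W"
      using openin_consistent_Filt_basic[OF W] by blast
    let ?V = "filt_basic X U \<inter> Collect consistent"
    have "V' \<subseteq> W" if V': "openin (consistent_Filt X) V'"
      "preimage_in X (nhd_filter X) V' \<subseteq> preimage_in X (nhd_filter X) ?V" for V'
    proof
      fix G assume G: "G \<in> V'"
      then obtain U' where U': "U' \<in> G" "openin X U'" "filt_basic X U' \<inter> Collect consistent \<subseteq> V'"
        using openin_consistent_Filt_basic[OF V'(1) G] by blast
      \<comment> \<open>inclusion of open sets of filters is detected on the neighbourhood filters\<close>
      have "U' \<subseteq> U" using pre[OF U'(2)] pre[OF U(2)] U'(3) V'(2) by blast
      moreover have "G \<in> topspace (consistent_Filt X)" using G V' openin_subset by blast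
      ultimately have "G \<in> ?V"
        using topological_filter_upward[OF _ U'(1) U(2)]
        by (simp add: topspace_consistent_Filt filt_basic_def)
      with U show "G \<in> W" by blast
    qed
    moreover have "openin (consistent_Filt X) ?V"
      unfolding consistent_Filt_def openin_subtopology using openin_filt_basic by blast
    moreover have "F \<in> ?V"
      using W openin_subset[OF W(1)] U by (auto simp: topspace_consistent_Filt filt_basic_def)
    ultimately show ?thesis using U by blast
  qed
  then have "filterhaft X (consistent_Filt X) (nhd_filter X)"
    using cont by (simp add: filterhaft_def)
  then show ?thesis
    using emb
    by (simp add: filtrum_extension_def dense_embedding_def t0_space_consistent_Filt
        dense_in_consistent_Filt)
qed

theorem mainTheorem5:
  fixes X :: "'a topology"
  shows
    "(\<forall>(Y :: 'b topology) \<phi>. filterhaft X Y \<phi> \<and> t0_space Y \<longrightarrow>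
        embedding_map Y (Filt X) (filter_map X Y \<phi>) \<and>
        (dense_embedding X Y \<phi> \<longrightarrow>
           dense_embedding Y (consistent_Filt X) (filter_map X Y \<phi>) \<and>
           (\<forall>x\<in>topspace X. filter_map X Y \<phi> (\<phi> x) = nhd_filter X x) \<and>
           (\<forall>\<psi>. dense_embedding Y (consistent_Filt X) \<psi> \<and>
                 (\<forall>x\<in>topspace X. \<psi> (\<phi> x) = nhd_filter X x) \<longrightarrow>
              (\<forall>y\<in>topspace Y. \<psi> y = filter_map X Y \<phi> y))))
     \<and>
     (\<forall>(Y :: 'b topology) \<phi>. filtrum_extension X Y \<phi> \<longrightarrow>
        (\<exists>!Y'. nhd_filter X ` topspace X \<subseteq> Y' \<and> Y' \<subseteq> topspace (consistent_Filt X) \<and>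
           (\<exists>h. homeomorphic_map Y (subtopology (consistent_Filt X) Y') h \<and>
                (\<forall>x\<in>topspace X. h (\<phi> x) = nhd_filter X x))))
     \<and>
     (t0_space X \<longrightarrow>
        filtrum_extension X (consistent_Filt X) (nhd_filter X) \<and>
        (\<forall>(Y :: 'b topology) \<phi>. filtrum_extension X Y \<phi> \<longrightarrow>
           (\<exists>!\<psi>. \<psi> \<in> extensional (topspace Y) \<and>
              embedding_map Y (consistent_Filt X) \<psi> \<and>
              (\<forall>x\<in>topspace X. \<psi> (\<phi> x) = nhd_filter X x))))"
proof (intro conjI allI impI)
  fix Y :: "'b topology" and \<phi>
  assume *: "filterhaft X Y \<phi> \<and> t0_space Y"
  then show "embedding_map Y (Filt X) (filter_map X Y \<phi>)"
    by (simp add: embedding_map_filter_map)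
  assume "dense_embedding X Y \<phi>"
  with * have fe: "filtrum_extension X Y \<phi>" by (simp add: filtrum_extension_def)
  then show "dense_embedding Y (consistent_Filt X) (filter_map X Y \<phi>)"
    by (rule dense_embedding_filter_map)
  show "\<forall>x\<in>topspace X. filter_map X Y \<phi> (\<phi> x) = nhd_filter X x"
    using \<open>dense_embedding X Y \<phi>\<close>
    by (simp add: dense_embedding_def filter_map_image_eq_nhd_filter)
  fix \<psi>
  assume "dense_embedding Y (consistent_Filt X) \<psi> \<and>
    (\<forall>x\<in>topspace X. \<psi> (\<phi> x) = nhd_filter X x)"
  with fe show "\<forall>y\<in>topspace Y. \<psi> y = filter_map X Y \<phi> y"
    by (simp add: filtrum_extension_unique dense_embedding_def)
next
  fix Y :: "'b topology" and \<phi>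
  assume fe: "filtrum_extension X Y \<phi>"
  let ?Z = "consistent_Filt X" and ?\<psi> = "filter_map X Y \<phi>"
  have emb: "embedding_map Y ?Z ?\<psi>"
    using dense_embedding_filter_map[OF fe] by (simp add: dense_embedding_def)
  have comp: "\<forall>x\<in>topspace X. ?\<psi> (\<phi> x) = nhd_filter X x"
    using fe by (simp add: filtrum_extension_def dense_embedding_def
        filter_map_image_eq_nhd_filter)
  have \<phi>: "\<phi> x \<in> topspace Y" if "x \<in> topspace X" for x
    using fe that by (auto simp: filtrum_extension_def filterhaft_def continuous_map_def)
  show "\<exists>!Y'. nhd_filter X ` topspace X \<subseteq> Y' \<and> Y' \<subseteq> topspace ?Z \<and>
      (\<exists>h. homeomorphic_map Y (subtopology ?Z Y') h \<and>
        (\<forall>x\<in>topspace X. h (\<phi> x) = nhd_filter X x))"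
  proof (rule ex1I[of _ "?\<psi> ` topspace Y"], intro conjI)
    show "nhd_filter X ` topspace X \<subseteq> ?\<psi> ` topspace Y"
      using comp \<phi> by (metis image_eqI image_subsetI)
    show "?\<psi> ` topspace Y \<subseteq> topspace ?Z"
      using embedding_imp_continuous_map[OF emb] by (simp add: continuous_map_image_subset_topspace)
    show "\<exists>h. homeomorphic_map Y (subtopology ?Z (?\<psi> ` topspace Y)) h \<and>
        (\<forall>x\<in>topspace X. h (\<phi> x) = nhd_filter X x)"
      using emb comp by (auto simp: embedding_map_def)
  next
    fix Y'
    assume Y': "nhd_filter X ` topspace X \<subseteq> Y' \<and> Y' \<subseteq> topspace ?Z \<and>
      (\<exists>h. homeomorphic_map Y (subtopology ?Z Y') h \<and>
        (\<forall>x\<in>topspace X. h (\<phi> x) = nhd_filter X x))"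
    then obtain h where h: "homeomorphic_map Y (subtopology ?Z Y') h"
      "\<And>x. x \<in> topspace X \<Longrightarrow> h (\<phi> x) = nhd_filter X x" by blast
    have im: "h ` topspace Y = Y'"
      using homeomorphic_imp_surjective_map[OF h(1)] Y' by auto
    then have "embedding_map Y ?Z h" using h(1) by (simp add: embedding_map_def)
    then have "h y = ?\<psi> y" if "y \<in> topspace Y" for y
      using filtrum_extension_unique[OF fe] h(2) that by blast
    with im show "Y' = ?\<psi> ` topspace Y" by (metis image_cong)
  qed
next
  assume "t0_space X"
  then show "filtrum_extension X (consistent_Filt X) (nhd_filter X)"
    by (rule filtrum_extension_consistent_Filt)
next
  fix Y :: "'b topology" and \<phi>
  assume fe: "filtrum_extension X Y \<phi>"
  let ?Z = "consistent_Filt X" and ?\<psi> = "restrict (filter_map X Y \<phi>) (topspace Y)"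
  have "embedding_map Y ?Z (filter_map X Y \<phi>)"
    using dense_embedding_filter_map[OF fe] by (simp add: dense_embedding_def)
  then have emb: "embedding_map Y ?Z ?\<psi>"
    by (rule embedding_map_eq) simp
  have comp: "\<forall>x\<in>topspace X. ?\<psi> (\<phi> x) = nhd_filter X x"
    using fe by (auto simp: filtrum_extension_def filterhaft_def continuous_map_def
        dense_embedding_def filter_map_image_eq_nhd_filter)
  show "\<exists>!\<psi>. \<psi> \<in> extensional (topspace Y) \<and> embedding_map Y ?Z \<psi> \<and>
      (\<forall>x\<in>topspace X. \<psi> (\<phi> x) = nhd_filter X x)"
  proof (rule ex1I[of _ ?\<psi>])
    show "?\<psi> \<in> extensional (topspace Y) \<and> embedding_map Y ?Z ?\<psi> \<and>
      (\<forall>x\<in>topspace X. ?\<psi> (\<phi> x) = nhd_filter X x)"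
      using emb comp by blast
  next
    fix \<psi> assume \<psi>: "\<psi> \<in> extensional (topspace Y) \<and> embedding_map Y ?Z \<psi> \<and>
      (\<forall>x\<in>topspace X. \<psi> (\<phi> x) = nhd_filter X x)"
    show "\<psi> = ?\<psi>"
    proof (rule extensionalityI[of _ "topspace Y"])
      show "\<psi> y = ?\<psi> y" if "y \<in> topspace Y" for y
        using filtrum_extension_unique[OF fe, of \<psi> y] \<psi> that by simp
    qed (use \<psi> in auto)
  qed
qed

end
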